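(* Let $(M,\omega)$ be an exact symplectic manifold of dimension $2n$. The elementary Liouvillian form $\theta_0$ on $(M,\omega)$ produces on the product manifold $(\tilde M,\omega_\ominus)$ a Liouvillian form given by $$\theta=\pi_1^*\theta_0-\pi_2^*\theta_0=\tfrac12\,dz_0\,J\,z_0-\tfrac12\,dz_h\,J\,z_h,$$ which in Darboux coordinates $z_0=(q_0,p_0)$, $z_h=(q_h,p_h)$ is $$\theta=\tfrac12\left(p_0\,dq_0-q_0\,dp_0-p_h\,dq_h+q_h\,dp_h\right),$$ and the generalized symplectic Euler scheme associated with this form is the symplectic mid-point rule $$z_h=z_0+hX_H\!\left(\tfrac12(z_0+z_h)\right).$$
   Context: One works in local coordinates $z$ on $M$ in which $\omega=\sum_{i,j}\tfrac12J_{ij}\,dz_j\wedge dz_i$ with $J$ a constant real matrix, $J^T=-J$, $J^2=-I_{2n}$; in Darboux coordinates $z=(q,p)$, $\omega=\sum_i dp_i\wedge dq_i$ and $J=\begin{pmatrix}0&I\\-I&0\end{pmatrix}$ (summation over components is understood in $p_0\,dq_0$, etc.). For a matrix $A$, the notation $dz\,A\,z$ means $\sum_{i,j}A_{ij}z_j\,dz_i$. A 1-form is Liouvillian on a symplectic manifold $(N,\sigma)$ if its differential is $\sigma$. The elementary Liouvillian form on $(M,\omega)$ is $\theta_0=\tfrac12\,dz\,J\,z$ (no symmetric component). The product manifold is $\tilde M=M_1\times M_2$, with $M_1,M_2$ two copies of $M$, projections $\pi_i:\tilde M\to M_i$, and symplectic form $\omega_\ominus=\pi_1^*\omega-\pi_2^*\omega$;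 coordinates are $(z_0,z_h)$. To a symmetric matrix $S$ one associates the Liouvillian form $\pi_1^*\theta_1-\pi_2^*\theta_2$ on $\tilde M$ with $\theta_1=dz(\tfrac12J+S)z$ and $\theta_2=dz(\tfrac12J-S)z$, and the Hamiltonian matrix $b=JS$. The generalized (implicit) symplectic Euler scheme associated with this form, for a Hamiltonian vector field $X_H$ ($i_{X_H}\omega=-dH$) and step size $h$, is the implicit map $z_0\mapsto z_h$ defined by $z_h=z_0+hX_H(\bar{\mathbf z})$, $\bar{\mathbf z}=\tfrac12(z_0+z_h)+b(z_h-z_0)$. *)

theory Defs
  imports "HOL-Analysis.Analysis"
begin

text \<open>
  HOL-Analysis has no differentiable manifolds, so a smooth manifold is given here by an indexed
  atlas, and a tensor field by its representatives in all charts, which must be related by the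
  transition maps. Tangent vectors are written in the chart, as
  vectors of the model space.
\<close>

text \<open>Meaningful on open sets only, because the derivative is the full one.\<close>

primrec Ck_on :: "nat \<Rightarrow> ('a::real_normed_vector \<Rightarrow> 'b::real_normed_vector) \<Rightarrow> 'a set \<Rightarrow> bool" where
  "Ck_on 0 f S \<longleftrightarrow> continuous_on S f"
| "Ck_on (Suc k) f S \<longleftrightarrow>
     (\<forall>x\<in>S. f differentiable (at x)) \<and> (\<forall>v. Ck_on k (\<lambda>x. frechet_derivative f (at x) v) S)"

definition smooth_on :: "'a set \<Rightarrow> ('a::real_normed_vector \<Rightarrow> 'b::real_normed_vector) \<Rightarrow> bool" where
  "smooth_on S f \<longleftrightarrow> (\<forall>k. Ck_on k f S)"

record ('m, 'e, 'i) mfd =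
  mtop :: "'m topology"
  charts :: "'i set"
  cdom :: "'i \<Rightarrow> 'm set"
  coord :: "'i \<Rightarrow> 'm \<Rightarrow> 'e"

definition crange :: "('m, 'e, 'i) mfd \<Rightarrow> 'i \<Rightarrow> 'e set" where
  "crange M i = coord M i ` cdom M i"

definition cinv :: "('m, 'e, 'i) mfd \<Rightarrow> 'i \<Rightarrow> 'e \<Rightarrow> 'm" where
  "cinv M i = inv_into (cdom M i) (coord M i)"

definition transition :: "('m, 'e, 'i) mfd \<Rightarrow> 'i \<Rightarrow> 'i \<Rightarrow> 'e \<Rightarrow> 'e" where
  "transition M i j = coord M j \<circ> cinv M i"

definition overlap :: "('m, 'e, 'i) mfd \<Rightarrow> 'i \<Rightarrow> 'i \<Rightarrow> 'e set" where
  "overlap M i j = coord M i ` (cdom M i \<inter> cdom M j)"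

definition smooth_manifold :: "('m, 'e::euclidean_space, 'i) mfd \<Rightarrow> bool" where
  "smooth_manifold M \<longleftrightarrow>
     Hausdorff_space (mtop M) \<and> second_countable (mtop M) \<and>
     (\<Union>i\<in>charts M. cdom M i) = topspace (mtop M) \<and>
     (\<forall>i\<in>charts M. openin (mtop M) (cdom M i) \<and> open (crange M i) \<and>
        homeomorphic_map (subtopology (mtop M) (cdom M i)) (top_of_set (crange M i)) (coord M i)) \<and>
     (\<forall>i\<in>charts M. \<forall>j\<in>charts M. smooth_on (overlap M i j) (transition M i j))"

definition smooth_function :: "('m, 'e::euclidean_space, 'i) mfd \<Rightarrow> ('m \<Rightarrow> real) \<Rightarrow> bool" where
  "smooth_function M f \<longleftrightarrow> (\<forall>i\<in>charts M. smooth_on (crange M i) (f \<circ> cinv M i))"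

definition prod_mfd :: "('m, 'e, 'i) mfd \<Rightarrow> ('l, 'f, 'j) mfd \<Rightarrow> ('m \<times> 'l, 'e \<times> 'f, 'i \<times> 'j) mfd" where
  "prod_mfd M N = \<lparr> mtop = prod_topology (mtop M) (mtop N), charts = charts M \<times> charts N,
     cdom = (\<lambda>(i, j). cdom M i \<times> cdom N j), coord = (\<lambda>(i, j). map_prod (coord M i) (coord N j)) \<rparr>"

text \<open>The domain of the chart \<open>i\<close> as an open submanifold.\<close>

definition chart_mfd :: "('m, 'e, 'i) mfd \<Rightarrow> 'i \<Rightarrow> ('m, 'e, 'i) mfd" where
  "chart_mfd M i = M\<lparr> mtop := subtopology (mtop M) (cdom M i), charts := {i} \<rparr>"

text \<open>\<open>\<alpha> i x v\<close> is the value on \<open>v\<close>, at the point with coordinates \<open>x\<close>, of the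
  representative of \<open>\<alpha>\<close> in the chart \<open>i\<close>.\<close>

type_synonym ('i, 'e) form1 = "'i \<Rightarrow> 'e \<Rightarrow> 'e \<Rightarrow> real"
type_synonym ('i, 'e) form2 = "'i \<Rightarrow> 'e \<Rightarrow> 'e \<Rightarrow> 'e \<Rightarrow> real"

definition pullback1 ::
  "('e::real_normed_vector \<Rightarrow> 'f::real_normed_vector) \<Rightarrow> ('f \<Rightarrow> 'f \<Rightarrow> real) \<Rightarrow> 'e \<Rightarrow> 'e \<Rightarrow> real" where
  "pullback1 f \<alpha> x v = \<alpha> (f x) (frechet_derivative f (at x) v)"

definition pullback2 ::
  "('e::real_normed_vector \<Rightarrow> 'f::real_normed_vector) \<Rightarrow> ('f \<Rightarrow> 'f \<Rightarrow> 'f \<Rightarrow> real) \<Rightarrow> 'e \<Rightarrow> 'e \<Rightarrow> 'e \<Rightarrow> real" where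
  "pullback2 f \<omega> x u v =
     \<omega> (f x) (frechet_derivative f (at x) u) (frechet_derivative f (at x) v)"

text \<open>Convention: \<open>(a \<and> b)(u, v) = a(u) b(v) - a(v) b(u)\<close>, so that
  \<open>d(f dx) = df \<and> dx\<close>.\<close>

definition wedge :: "('e \<Rightarrow> real) \<Rightarrow> ('e \<Rightarrow> real) \<Rightarrow> 'e \<Rightarrow> 'e \<Rightarrow> real" where
  "wedge a b u v = a u * b v - a v * b u"

definition ext_d1 :: "('e::real_normed_vector \<Rightarrow> 'e \<Rightarrow> real) \<Rightarrow> 'e \<Rightarrow> 'e \<Rightarrow> 'e \<Rightarrow> real" where
  "ext_d1 \<alpha> x u v =
     frechet_derivative (\<lambda>y. \<alpha> y v) (at x) u - frechet_derivative (\<lambda>y. \<alpha> y u) (at x) v"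

definition ext_d2 ::
  "('e::real_normed_vector \<Rightarrow> 'e \<Rightarrow> 'e \<Rightarrow> real) \<Rightarrow> 'e \<Rightarrow> 'e \<Rightarrow> 'e \<Rightarrow> 'e \<Rightarrow> real" where
  "ext_d2 \<omega> x u v w =
     frechet_derivative (\<lambda>y. \<omega> y v w) (at x) u - frechet_derivative (\<lambda>y. \<omega> y u w) (at x) v
     + frechet_derivative (\<lambda>y. \<omega> y u v) (at x) w"

definition one_form :: "('m, 'e::euclidean_space, 'i) mfd \<Rightarrow> ('i, 'e) form1 \<Rightarrow> bool" where
  "one_form M \<alpha> \<longleftrightarrow>
     (\<forall>i\<in>charts M. (\<forall>x\<in>crange M i. linear (\<alpha> i x)) \<and> (\<forall>v. smooth_on (crange M i) (\<lambda>x. \<alpha> i x v))) \<and>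
     (\<forall>i\<in>charts M. \<forall>j\<in>charts M. \<forall>x\<in>overlap M i j.
        \<alpha> i x = pullback1 (transition M i j) (\<alpha> j) x)"

definition two_form :: "('m, 'e::euclidean_space, 'i) mfd \<Rightarrow> ('i, 'e) form2 \<Rightarrow> bool" where
  "two_form M \<omega> \<longleftrightarrow>
     (\<forall>i\<in>charts M. (\<forall>x\<in>crange M i. bilinear (\<omega> i x) \<and> (\<forall>u. \<omega> i x u u = 0)) \<and>
        (\<forall>u v. smooth_on (crange M i) (\<lambda>x. \<omega> i x u v))) \<and>
     (\<forall>i\<in>charts M. \<forall>j\<in>charts M. \<forall>x\<in>overlap M i j.
        \<omega> i x = pullback2 (transition M i j) (\<omega> j) x)"

definition symplectic_manifold :: "('m, 'e::euclidean_space, 'i) mfd \<Rightarrow> ('i, 'e) form2 \<Rightarrow> bool" where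
  "symplectic_manifold M \<omega> \<longleftrightarrow>
     smooth_manifold M \<and> two_form M \<omega> \<and>
     (\<forall>i\<in>charts M. \<forall>x\<in>crange M i.
        (\<forall>u v w. ext_d2 (\<omega> i) x u v w = 0) \<and> (\<forall>u. (\<forall>v. \<omega> i x u v = 0) \<longrightarrow> u = 0))"

definition liouvillian ::
  "('m, 'e::euclidean_space, 'i) mfd \<Rightarrow> ('i, 'e) form2 \<Rightarrow> ('i, 'e) form1 \<Rightarrow> bool" where
  "liouvillian M \<omega> \<alpha> \<longleftrightarrow>
     symplectic_manifold M \<omega> \<and> one_form M \<alpha> \<and>
     (\<forall>i\<in>charts M. \<forall>x\<in>crange M i. ext_d1 (\<alpha> i) x = \<omega> i x)"

definition exact_symplectic_manifold ::
  "('m, 'e::euclidean_space, 'i) mfd \<Rightarrow> ('i, 'e) form2 \<Rightarrow> bool" where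
  "exact_symplectic_manifold M \<omega> \<longleftrightarrow> symplectic_manifold M \<omega> \<and> (\<exists>\<alpha>. liouvillian M \<omega> \<alpha>)"

text \<open>\<open>\<pi>\<^sub>1\<^sup>*\<alpha> - \<pi>\<^sub>2\<^sup>*\<beta>\<close> on a product: in product charts the projections
  are represented by \<^const>\<open>fst\<close> and \<^const>\<open>snd\<close>.\<close>

definition ominus1 ::
  "('i, 'e::real_normed_vector) form1 \<Rightarrow> ('j, 'f::real_normed_vector) form1 \<Rightarrow> ('i \<times> 'j, 'e \<times> 'f) form1" where
  "ominus1 \<alpha> \<beta> = (\<lambda>(i, j) x v. pullback1 fst (\<alpha> i) x v - pullback1 snd (\<beta> j) x v)"

definition ominus2 ::
  "('i, 'e::real_normed_vector) form2 \<Rightarrow> ('j, 'f::real_normed_vector) form2 \<Rightarrow> ('i \<times> 'j, 'e \<times> 'f) form2" where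
  "ominus2 \<omega> \<sigma> = (\<lambda>(i, j) x u v. pullback2 fst (\<omega> i) x u v - pullback2 snd (\<sigma> j) x u v)"

text \<open>The 2-form \<open>\<Sum>\<^sub>i\<^sub>j (1/2) J\<^sub>i\<^sub>j dz\<^sub>j \<and> dz\<^sub>i\<close>.\<close>

definition const_form2 :: "real^'k^'k \<Rightarrow> real^'k \<Rightarrow> real^'k \<Rightarrow> real^'k \<Rightarrow> real" where
  "const_form2 J x u v =
     (\<Sum>i\<in>UNIV. \<Sum>j\<in>UNIV. 1/2 * J $ i $ j * wedge (\<lambda>w. w $ j) (\<lambda>w. w $ i) u v)"

definition symplectic_coords ::
  "('m, real^'k, 'i) mfd \<Rightarrow> ('i, real^'k) form2 \<Rightarrow> real^'k^'k \<Rightarrow> 'i \<Rightarrow> bool" where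
  "symplectic_coords M \<omega> J c \<longleftrightarrow>
     c \<in> charts M \<and> transpose J = - J \<and> J ** J = - mat 1 \<and>
     (\<forall>x\<in>crange M c. \<omega> c x = const_form2 J x)"

text \<open>The 1-form \<open>dz A z\<close>, evaluated at \<open>z\<close> on the tangent vector \<open>dz\<close>.\<close>

definition matrix_form :: "real^'k^'k \<Rightarrow> real^'k \<Rightarrow> real^'k \<Rightarrow> real" where
  "matrix_form A z dz = (\<Sum>i\<in>UNIV. \<Sum>j\<in>UNIV. A $ i $ j * z $ j * dz $ i)"

text \<open>Forms defined by coordinate formulas are only ever used on the domain of a single chart, so
  they do not depend on the chart index.\<close>

definition elementary_form :: "real^'k^'k \<Rightarrow> ('i, real^'k) form1" where
  "elementary_form J = (\<lambda>c. matrix_form ((1/2) *\<^sub>R J))"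

definition liouvillian_of :: "real^'k^'k \<Rightarrow> real^'k^'k \<Rightarrow> ('i \<times> 'i, (real^'k) \<times> (real^'k)) form1" where
  "liouvillian_of J S =
     ominus1 (\<lambda>c. matrix_form ((1/2) *\<^sub>R J + S)) (\<lambda>c. matrix_form ((1/2) *\<^sub>R J - S))"

definition qp :: "real^'n \<Rightarrow> real^'n \<Rightarrow> real^('n + 'n)" where
  "qp q p = (\<chi> a. case a of Inl i \<Rightarrow> q $ i | Inr i \<Rightarrow> p $ i)"

text \<open>The block matrix with blocks \<open>0, I, -I, 0\<close> with respect to \<^const>\<open>qp\<close>.\<close>

definition darboux_J :: "real^('n::finite + 'n)^('n + 'n)" where
  "darboux_J = (\<chi> a b. case a of
       Inl i \<Rightarrow> (case b of Inl j \<Rightarrow> 0 | Inr j \<Rightarrow> if i = j then 1 else 0)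
     | Inr i \<Rightarrow> (case b of Inl j \<Rightarrow> if i = j then -1 else 0 | Inr j \<Rightarrow> 0))"

text \<open>The vector field with \<open>i\<^sub>X \<omega> = - dH\<close>, in the chart \<open>c\<close>; it is uniquely determined
  because \<open>\<omega>\<close> is nondegenerate.\<close>

definition hamiltonian_field ::
  "('m, 'e::euclidean_space, 'i) mfd \<Rightarrow> ('i, 'e) form2 \<Rightarrow> ('m \<Rightarrow> real) \<Rightarrow> 'i \<Rightarrow> 'e \<Rightarrow> 'e" where
  "hamiltonian_field M \<omega> H c x =
     (THE u. \<forall>v. \<omega> c x u v = - frechet_derivative (H \<circ> cinv M c) (at x) v)"

text \<open>Since the maps are implicit, schemes are relations between \<open>z\<^sub>0\<close> and \<open>z\<^sub>h\<close>. \<open>V\<close> is the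
  coordinate range and \<open>X\<close> a vector field on it; the field can be evaluated only at points of \<open>V\<close>.\<close>

definition euler_scheme ::
  "(real^'k) set \<Rightarrow> real^'k^'k \<Rightarrow> real^'k^'k \<Rightarrow> (real^'k \<Rightarrow> real^'k) \<Rightarrow> real \<Rightarrow> ((real^'k) \<times> (real^'k)) set" where
  "euler_scheme V J S X h = {(z0, zh). z0 \<in> V \<and> zh \<in> V \<and>
     (let zbar = (1/2) *\<^sub>R (z0 + zh) + (J ** S) *v (zh - z0)
      in zbar \<in> V \<and> zh = z0 + h *\<^sub>R X zbar)}"

definition midpoint_rule ::
  "(real^'k) set \<Rightarrow> (real^'k \<Rightarrow> real^'k) \<Rightarrow> real \<Rightarrow> ((real^'k) \<times> (real^'k)) set" where
  "midpoint_rule V X h = {(z0, zh). z0 \<in> V \<and> zh \<in> V \<and> (1/2) *\<^sub>R (z0 + zh) \<in> V \<and>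
     zh = z0 + h *\<^sub>R X ((1/2) *\<^sub>R (z0 + zh))}"

text \<open>\<open>R\<close> is a scheme associated, in the coordinates \<open>c\<close> on both factors, with the Liouvillian
  form \<open>\<theta>\<close> on the product.\<close>

definition associated_euler_scheme ::
  "('m, real^'k, 'i) mfd \<Rightarrow> ('i, real^'k) form2 \<Rightarrow> real^'k^'k \<Rightarrow> 'i \<Rightarrow> ('i \<times> 'i, (real^'k) \<times> (real^'k)) form1 \<Rightarrow>
     ('m \<Rightarrow> real) \<Rightarrow> real \<Rightarrow> ((real^'k) \<times> (real^'k)) set \<Rightarrow> bool" where
  "associated_euler_scheme M \<omega> J c \<theta> H h R \<longleftrightarrow>
     (\<exists>S. transpose S = S \<and>
        (\<forall>x\<in>crange (prod_mfd M M) (c, c). \<theta> (c, c) x = liouvillian_of J S (c, c) x) \<and>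
        R = euler_scheme (crange M c) J S (hamiltonian_field M \<omega> H c) h)"

end

theory Submission
  imports Defs
begin

text \<open>
  In symplectic coordinates \<open>\<omega>\<close> has the constant value \<open>\<omega>(u, v) = Ju \<bullet> v\<close>, and
  \<open>dz A z = Az \<bullet> dz\<close> has exterior derivative \<open>Au \<bullet> v - Av \<bullet> u\<close>; for \<open>A = J/2\<close> this is
  \<open>\<omega>\<close> by antisymmetry. A symmetric matrix \<open>S\<close> represents \<open>\<theta>\<close> only if
  \<open>Sz\<^sub>0 \<bullet> dz\<^sub>0 + Sz\<^sub>h \<bullet> dz\<^sub>h = 0\<close>, that is, if \<open>S\<close> vanishes on the open coordinate range. Hence
  \<open>S = 0\<close>, so \<open>b = JS = 0\<close> and the scheme is the mid-point rule. An empty coordinate range leaves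
  \<open>S\<close> undetermined, but then every scheme is the empty relation.
\<close>

subsection \<open>Smooth functions on open sets\<close>

lemma frechet_derivative_bounded_linear:
  "bounded_linear f \<Longrightarrow> frechet_derivative f (at x) = f"
  by (metis bounded_linear_imp_has_derivative frechet_derivative_at)

text \<open>A Frechet derivative depends only on the values near the point, so on an open set
  \<open>f\<close> and \<open>g\<close> have equal directional derivatives. The induction on
  \<open>k\<close> passes to these, hence \<open>f\<close> and \<open>g\<close> are
  generalized.\<close>

lemma Ck_on_cong:
  assumes "open S" and "\<And>x. x \<in> S \<Longrightarrow> f x = g x" and "Ck_on k f S"
  shows "Ck_on k g S"
  using assms(2,3)
proof (induction k arbitrary: f g)
  case 0
  then show ?case by (simp cong: continuous_on_cong)
next
  case (Suc k)
  have diff: "f differentiable (at x)" if "x \<in> S" for x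
    using Suc.prems that by simp
  have "g differentiable (at x)" if "x \<in> S" for x
    using diff[OF that] that Suc.prems(1) \<open>open S\<close> unfolding differentiable_def
    by (meson has_derivative_transform_within_open)
  moreover have "Ck_on k (\<lambda>x. frechet_derivative g (at x) v) S" for v
  proof (rule Suc.IH)
    show "Ck_on k (\<lambda>x. frechet_derivative f (at x) v) S"
      using Suc.prems by simp
    show "frechet_derivative f (at x) v = frechet_derivative g (at x) v" if "x \<in> S" for x
      using frechet_derivative_transform_within_open[OF diff[OF that] \<open>open S\<close> that Suc.prems(1)]
      by simp
  qed
  ultimately show ?case by simp
qed

lemma smooth_on_cong:
  assumes "open S" and "\<And>x. x \<in> S \<Longrightarrow> f x = g x" and "smooth_on S f"
  shows "smooth_on S g"
  using assms(3) Ck_on_cong[OF assms(1,2)] unfolding smooth_on_def by simp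

lemma smooth_on_const: "smooth_on S (\<lambda>x. c)"
proof -
  have "Ck_on k (\<lambda>x. c) S" for k
    by (induction k arbitrary: c) auto
  then show ?thesis by (simp add: smooth_on_def)
qed

text \<open>One differentiation in direction \<open>v\<close> leaves the constant
  \<open>f v\<close>, so a case split on the order is enough and constants finish the proof.\<close>

lemma smooth_on_bounded_linear:
  assumes "bounded_linear f"
  shows "smooth_on S f"
proof -
  have "Ck_on k f S" for k
  proof (cases k)
    case 0
    then show ?thesis using assms by (simp add: linear_continuous_on)
  next
    case (Suc j)
    then show ?thesis
      using assms smooth_on_const[of S]
      by (auto simp: frechet_derivative_bounded_linear smooth_on_def
          intro: bounded_linear_imp_differentiable)
  qed
  then show ?thesis by (simp add: smooth_on_def)
qed

subsection \<open>Manifolds with a single chart\<close>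

lemma crange_chart_mfd [simp]: "crange (chart_mfd M i) = crange M"
  by (simp add: fun_eq_iff crange_def chart_mfd_def)

lemma charts_chart_mfd [simp]: "charts (chart_mfd M i) = {i}"
  by (simp add: chart_mfd_def)

lemma overlap_same: "overlap M i i = crange M i"
  by (simp add: overlap_def crange_def)

lemma transition_same: "x \<in> crange M i \<Longrightarrow> transition M i i x = x"
  by (simp add: transition_def cinv_def crange_def f_inv_into_f)

lemma frechet_derivative_transition_same:
  assumes "open (crange M i)" and "x \<in> crange M i"
  shows "frechet_derivative (transition M i i) (at x) = (\<lambda>v. v)"
proof -
  have "frechet_derivative (\<lambda>y. y) (at x) = frechet_derivative (transition M i i) (at x)"
    by (rule frechet_derivative_transform_within_open[OF _ assms]) (simp_all add: transition_same)
  then show ?thesis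
    by (simp add: frechet_derivative_bounded_linear bounded_linear_ident)
qed

text \<open>The only transition map is the identity on the open range. Only the chart
  \<open>i\<close> of \<open>M\<close> is assumed to be well behaved, so a product chart can be
  treated without proving smoothness of all product transition maps.\<close>

lemma smooth_manifold_chart_mfd:
  assumes "Hausdorff_space (mtop M)" and "second_countable (mtop M)"
    and "openin (mtop M) (cdom M i)" and "open (crange M i)"
    and "homeomorphic_map (subtopology (mtop M) (cdom M i)) (top_of_set (crange M i)) (coord M i)"
  shows "smooth_manifold (chart_mfd M i)"
proof -
  have "smooth_on (crange M i) (transition (chart_mfd M i) i i)"
    by (rule smooth_on_cong[OF assms(4) _ smooth_on_bounded_linear[OF bounded_linear_ident]])
      (simp add: transition_same)
  moreover have "mtop (chart_mfd M i) = subtopology (mtop M) (cdom M i)"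
    "cdom (chart_mfd M i) = cdom M" "coord (chart_mfd M i) = coord M"
    by (simp_all add: chart_mfd_def)
  moreover have "topspace (subtopology (mtop M) (cdom M i)) = cdom M i"
    using openin_subset[OF assms(3)] by auto
  moreover have "openin (subtopology (mtop M) (cdom M i)) (cdom M i)"
    using assms(3) by (simp add: openin_subset openin_open_subtopology)
  ultimately show ?thesis
    using assms
    by (simp add: smooth_manifold_def overlap_same Hausdorff_space_subtopology
        second_countable_subtopology subtopology_subtopology)
qed

text \<open>Compatibility under the identity transition holds automatically, which leaves only the
  conditions inside the chart.\<close>

lemma one_form_chart_mfd:
  assumes "open (crange M i)"
  shows "one_form (chart_mfd M i) \<alpha> \<longleftrightarrow>
    (\<forall>x\<in>crange M i. linear (\<alpha> i x)) \<and> (\<forall>v. smooth_on (crange M i) (\<lambda>x. \<alpha> i x v))"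
proof -
  have "\<alpha> i x = pullback1 (transition (chart_mfd M i) i i) (\<alpha> i) x" if "x \<in> crange M i" for x
    using that assms frechet_derivative_transition_same[of "chart_mfd M i" i x]
    by (simp add: fun_eq_iff pullback1_def transition_same)
  then show ?thesis
    unfolding one_form_def by (auto simp: overlap_same)
qed

lemma two_form_chart_mfd:
  assumes "open (crange M i)"
  shows "two_form (chart_mfd M i) \<omega> \<longleftrightarrow>
    (\<forall>x\<in>crange M i. bilinear (\<omega> i x) \<and> (\<forall>u. \<omega> i x u u = 0)) \<and>
    (\<forall>u v. smooth_on (crange M i) (\<lambda>x. \<omega> i x u v))"
proof -
  have "\<omega> i x = pullback2 (transition (chart_mfd M i) i i) (\<omega> i) x" if "x \<in> crange M i" for x
    using that assms frechet_derivative_transition_same[of "chart_mfd M i" i x]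
    by (simp add: fun_eq_iff pullback2_def transition_same)
  then show ?thesis
    unfolding two_form_def by (auto simp: overlap_same)
qed

text \<open>Every condition on \<open>\<omega>\<close> is imposed chart by chart or on pairs of
  charts, so it survives passing to a single one.\<close>

lemma symplectic_chart_mfd:
  assumes "symplectic_manifold M \<omega>" and "i \<in> charts M"
  shows "symplectic_manifold (chart_mfd M i) \<omega>"
proof -
  have M: "smooth_manifold M" and \<omega>: "two_form M \<omega>"
    using assms(1) by (auto simp: symplectic_manifold_def)
  then have "open (crange M i)"
    using assms(2) by (simp add: smooth_manifold_def)
  moreover have "smooth_manifold (chart_mfd M i)"
    by (rule smooth_manifold_chart_mfd) (use M assms(2) in \<open>simp_all add: smooth_manifold_def\<close>)
  ultimately show ?thesis
    using assms \<omega> two_form_chart_mfd[of M i \<omega>]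
    unfolding symplectic_manifold_def two_form_def[of M] by simp
qed

subsection \<open>Products\<close>

lemma second_countable_prod_topology:
  assumes "second_countable X" and "second_countable Y"
  shows "second_countable (prod_topology X Y)"
proof -
  obtain \<B> where \<B>: "countable \<B>" "\<And>V. V \<in> \<B> \<Longrightarrow> openin X V"
    "\<And>U x. \<lbrakk>openin X U; x \<in> U\<rbrakk> \<Longrightarrow> \<exists>V\<in>\<B>. x \<in> V \<and> V \<subseteq> U"
    using assms(1) by (auto simp: second_countable_def)
  obtain \<C> where \<C>: "countable \<C>" "\<And>V. V \<in> \<C> \<Longrightarrow> openin Y V"
    "\<And>U x. \<lbrakk>openin Y U; x \<in> U\<rbrakk> \<Longrightarrow> \<exists>V\<in>\<C>. x \<in> V \<and> V \<subseteq> U"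
    using assms(2) by (auto simp: second_countable_def)
  show ?thesis
    unfolding second_countable_def
  proof (intro exI conjI allI impI ballI)
    show "countable ((\<lambda>(V, W). V \<times> W) ` (\<B> \<times> \<C>))"
      using \<B>(1) \<C>(1) by simp
    show "openin (prod_topology X Y) T" if "T \<in> (\<lambda>(V, W). V \<times> W) ` (\<B> \<times> \<C>)" for T
      using that \<B>(2) \<C>(2) by (auto simp: openin_prod_Times_iff)
    fix U z
    assume z: "openin (prod_topology X Y) U \<and> z \<in> U"
    obtain x y where xy: "z = (x, y)" by fastforce
    with z obtain V W where VW: "openin X V" "openin Y W" "x \<in> V" "y \<in> W" "V \<times> W \<subseteq> U"
      unfolding openin_prod_topology_alt by blast
    obtain V' where "V' \<in> \<B>" "x \<in> V'" "V' \<subseteq> V"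
      using \<B>(3) VW by blast
    moreover obtain W' where "W' \<in> \<C>" "y \<in> W'" "W' \<subseteq> W"
      using \<C>(3) VW by blast
    ultimately show "\<exists>T\<in>(\<lambda>(V, W). V \<times> W) ` (\<B> \<times> \<C>). z \<in> T \<and> T \<subseteq> U"
      using VW(5) xy by (intro bexI[of _ "V' \<times> W'"]) auto
  qed
qed

lemma homeomorphic_map_map_prod:
  assumes "homeomorphic_map X X' f" and "homeomorphic_map Y Y' g"
  shows "homeomorphic_map (prod_topology X Y) (prod_topology X' Y') (map_prod f g)"
proof -
  obtain f' g' where "homeomorphic_maps X X' f f'" and "homeomorphic_maps Y Y' g g'"
    using assms by (auto simp: homeomorphic_map_maps)
  then have "homeomorphic_maps (prod_topology X Y) (prod_topology X' Y')
      (\<lambda>(x, y). (f x, g y)) (\<lambda>(x, y). (f' x, g' y))"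
    by (simp add: homeomorphic_maps_prod)
  then show ?thesis
    by (auto simp: homeomorphic_map_maps map_prod_def)
qed

lemma crange_prod_mfd: "crange (prod_mfd M N) (i, j) = crange M i \<times> crange N j"
  by (auto simp: crange_def prod_mfd_def)

lemma smooth_manifold_chart_prod_mfd:
  assumes "smooth_manifold M" and "smooth_manifold N" and "i \<in> charts M" and "j \<in> charts N"
  shows "smooth_manifold (chart_mfd (prod_mfd M N) (i, j))"
proof (rule smooth_manifold_chart_mfd)
  have M: "Hausdorff_space (mtop M)" "second_countable (mtop M)"
    "openin (mtop M) (cdom M i)" "open (crange M i)"
    "homeomorphic_map (subtopology (mtop M) (cdom M i)) (top_of_set (crange M i)) (coord M i)"
    using assms by (auto simp: smooth_manifold_def)
  have N: "Hausdorff_space (mtop N)" "second_countable (mtop N)"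
    "openin (mtop N) (cdom N j)" "open (crange N j)"
    "homeomorphic_map (subtopology (mtop N) (cdom N j)) (top_of_set (crange N j)) (coord N j)"
    using assms by (auto simp: smooth_manifold_def)
  show "Hausdorff_space (mtop (prod_mfd M N))"
    using M N by (simp add: prod_mfd_def Hausdorff_space_prod_topology)
  show "second_countable (mtop (prod_mfd M N))"
    using M N by (simp add: prod_mfd_def second_countable_prod_topology)
  show "openin (mtop (prod_mfd M N)) (cdom (prod_mfd M N) (i, j))"
    using M N by (simp add: prod_mfd_def openin_prod_Times_iff)
  show "open (crange (prod_mfd M N) (i, j))"
    using M N by (simp add: crange_prod_mfd open_Times)
  \<comment> \<open>The product of the two chart homeomorphisms lands in the product of the subspace
    topologies, which has to be identified with the subspace topology of the product range.\<close>
  have "top_of_set (crange M i \<times> crange N j) =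
      prod_topology (top_of_set (crange M i)) (top_of_set (crange N j))"
    by (simp flip: subtopology_Times)
  then show "homeomorphic_map (subtopology (mtop (prod_mfd M N)) (cdom (prod_mfd M N) (i, j)))
      (top_of_set (crange (prod_mfd M N) (i, j))) (coord (prod_mfd M N) (i, j))"
    using homeomorphic_map_map_prod[OF M(5) N(5)]
    unfolding crange_prod_mfd by (simp add: prod_mfd_def subtopology_Times)
qed

lemma frechet_derivative_fst: "frechet_derivative fst (at x) = fst"
  by (rule frechet_derivative_bounded_linear) (rule bounded_linear_fst)

lemma frechet_derivative_snd: "frechet_derivative snd (at x) = snd"
  by (rule frechet_derivative_bounded_linear) (rule bounded_linear_snd)

lemma ominus1_apply:
  "ominus1 \<alpha> \<beta> (i, j) x v = \<alpha> i (fst x) (fst v) - \<beta> j (snd x) (snd v)"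
  by (simp add: ominus1_def pullback1_def frechet_derivative_fst frechet_derivative_snd)

lemma ominus2_apply:
  "ominus2 \<omega> \<sigma> (i, j) x u v = \<omega> i (fst x) (fst u) (fst v) - \<sigma> j (snd x) (snd u) (snd v)"
  by (simp add: ominus2_def pullback2_def frechet_derivative_fst frechet_derivative_snd)

subsection \<open>Forms given by matrices\<close>

text \<open>Inner products replace the double sums from here on, so that antisymmetry can be used by
  moving \<open>J\<close> across.\<close>

lemma matrix_form_inner: "matrix_form A z dz = (A *v z) \<bullet> dz"
  by (simp add: matrix_form_def inner_vec_def matrix_vector_mult_def sum_distrib_right)

lemma bounded_linear_matrix_form: "bounded_linear (\<lambda>z. matrix_form A z dz)"
  unfolding matrix_form_inner
  by (intro bounded_linear_inner_left_comp matrix_vector_mul_bounded_linear)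

lemma linear_matrix_form: "linear (matrix_form A z)"
  by (simp add: matrix_form_inner linear_iff inner_right_distrib)

lemma uminus_matrix_vector_mult: "(- A) *v x = - (A *v x)" for A :: "real^'k^'l"
  by (simp add: matrix_vector_mult_def vec_eq_iff sum_negf)

lemma antisym_inner:
  fixes J :: "real^'k^'k"
  assumes "transpose J = - J"
  shows "(J *v u) \<bullet> v = - ((J *v v) \<bullet> u)"
proof -
  have "(J *v u) \<bullet> v = u \<bullet> (transpose J *v v)"
    by (simp add: inner_commute dot_lmul_matrix del: vector_transpose_matrix)
      (metis dot_lmul_matrix inner_commute)
  also have "transpose J *v v = - (J *v v)"
    unfolding assms by (rule uminus_matrix_vector_mult)
  finally show ?thesis by (simp add: inner_commute)
qed

text \<open>The wedge yields half the difference of \<open>(J *v u) \<bullet> v\<close> and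
  \<open>(J *v v) \<bullet> u\<close>; these are opposite by antisymmetry, which absorbs the factor
  1/2.\<close>

lemma const_form2_inner:
  fixes J :: "real^'k^'k"
  assumes "transpose J = - J"
  shows "const_form2 J x u v = (J *v u) \<bullet> v"
proof -
  have "const_form2 J x u v = 1/2 * (matrix_form J u v - matrix_form J v u)"
    unfolding const_form2_def matrix_form_def wedge_def sum_subtractf[symmetric] sum_distrib_left
    by (intro sum.cong refl) (simp add: algebra_simps)
  then show ?thesis
    using antisym_inner[OF assms, of v u] by (simp add: matrix_form_inner)
qed

text \<open>Applying \<open>J\<close> once more returns \<open>- u\<close>. This gives nondegeneracy
  of the form on the product.\<close>

lemma complex_structure_mult_eq_0:
  fixes J :: "real^'k^'k"
  assumes "J ** J = - mat 1" and "J *v u = 0"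
  shows "u = 0"
proof -
  have "0 = J *v (J *v u)" using assms(2) by simp
  also have "\<dots> = (- mat 1) *v u"
    by (simp add: matrix_vector_mul_assoc assms(1))
  also have "\<dots> = - u"
    by (simp add: uminus_matrix_vector_mult)
  finally show ?thesis by simp
qed

lemma matrix_eq_0_if_vanishes_on_open:
  fixes A :: "real^'k^'l"
  assumes "open V" and "x \<in> V" and "\<And>z. z \<in> V \<Longrightarrow> A *v z = 0"
  shows "A = 0"
proof -
  obtain e where e: "e > 0" "ball x e \<subseteq> V"
    using assms(1,2) open_contains_ball by blast
  have "A *v v = 0" for v
  proof -
    \<comment> \<open>The summand 1 keeps the denominator positive when \<open>v = 0\<close>; the
      factor 2 gives \<open>t * norm v \<le> e / 2\<close>, so \<open>x + t *\<^sub>R v\<close>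
      stays in the ball. Subtracting the zero values at \<open>x + t *\<^sub>R v\<close> and
      \<open>x\<close> leaves \<open>A *v v = 0\<close>.\<close>
    define t where "t = e / (2 * (norm v + 1))"
    have t: "t > 0" using e by (simp add: t_def add_nonneg_pos)
    have "t * norm v < e"
    proof -
      have "t * norm v \<le> t * (norm v + 1)" using t by simp
      also have "\<dots> = e / 2" by (simp add: t_def field_simps add_nonneg_eq_0_iff)
      finally show ?thesis using e by simp
    qed
    then have "x + t *\<^sub>R v \<in> V"
      using e t by (auto simp: dist_norm)
    then have "A *v (x + t *\<^sub>R v) = 0" and "A *v x = 0"
      using assms by auto
    then show ?thesis
      using t by (simp add: matrix_vector_right_distrib matrix_vector_mult_scaleR)
  qed
  then show ?thesis by (simp add: matrix_eq)
qed

lemma frechet_derivative_matrix_form: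
  "frechet_derivative (\<lambda>y. matrix_form A y v) (at x) u = matrix_form A u v"
  by (simp add: frechet_derivative_bounded_linear bounded_linear_matrix_form)

section \<open>Liouvillian property on the chart and on the product chart\<close>

lemma ext_d1_elementary_form:
  fixes J :: "real^'k^'k"
  assumes "transpose J = - J"
  shows "ext_d1 (elementary_form J c) x u v = (J *v u) \<bullet> v"
  unfolding ext_d1_def elementary_form_def frechet_derivative_matrix_form
  \<comment> \<open>The form is linear in the base point, so its derivative is the form itself;
    antisymmetry makes the two halves add up.\<close>
  using antisym_inner[OF assms, of v u]
  by (simp add: matrix_form_inner scaleR_matrix_vector_assoc[symmetric])

lemma liouvillian_elementary_form:
  assumes "symplectic_manifold M \<omega>" and "symplectic_coords M \<omega> J c"
  shows "liouvillian (chart_mfd M c) \<omega> (elementary_form J)"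
proof -
  have c: "c \<in> charts M" and J: "transpose J = - J"
    and \<omega>: "\<And>x. x \<in> crange M c \<Longrightarrow> \<omega> c x = const_form2 J x"
    using assms(2) by (auto simp: symplectic_coords_def)
  have "open (crange M c)"
    using assms(1) c by (auto simp: symplectic_manifold_def smooth_manifold_def)
  then have "one_form (chart_mfd M c) (elementary_form J)"
    by (simp add: one_form_chart_mfd elementary_form_def linear_matrix_form
        smooth_on_bounded_linear bounded_linear_matrix_form)
  then show ?thesis
    using symplectic_chart_mfd[OF assms(1) c]
    by (simp add: liouvillian_def fun_eq_iff \<omega> ext_d1_elementary_form[OF J] const_form2_inner[OF J])
qed

text \<open>In the product chart the form has constant coefficients, hence is smooth and closed.
  Nondegeneracy is checked on each factor separately, where the sign is irrelevant.\<close>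

lemma symplectic_chart_prod_mfd:
  assumes "symplectic_manifold M \<omega>" and "symplectic_coords M \<omega> J c"
  shows "symplectic_manifold (chart_mfd (prod_mfd M M) (c, c)) (ominus2 \<omega> \<omega>)"
proof -
  have c: "c \<in> charts M" and J: "transpose J = - J" "J ** J = - mat 1"
    and coords: "\<And>x. x \<in> crange M c \<Longrightarrow> \<omega> c x = const_form2 J x"
    using assms(2) by (auto simp: symplectic_coords_def)
  have M: "smooth_manifold M"
    using assms(1) by (simp add: symplectic_manifold_def)
  let ?V = "crange (prod_mfd M M) (c, c)"
  \<comment> \<open>The constant value of the form on \<open>?V\<close>. It is known only there, so
    smoothness and closedness below go through agreement with a constant on an open set.\<close>
  let ?w = "\<lambda>u v. (J *v fst u) \<bullet> fst v - (J *v snd u) \<bullet> snd v"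
  have \<omega>: "ominus2 \<omega> \<omega> (c, c) x u v = ?w u v" if "x \<in> ?V" for x u v
    using that by (auto simp: ominus2_apply crange_prod_mfd coords const_form2_inner[OF J(1)])
  have op: "open ?V"
    using M c by (simp add: crange_prod_mfd open_Times smooth_manifold_def)
  have "two_form (chart_mfd (prod_mfd M M) (c, c)) (ominus2 \<omega> \<omega>)"
    unfolding two_form_chart_mfd[OF op]
  proof (intro conjI ballI allI)
    fix x u assume x: "x \<in> ?V"
    show "bilinear (ominus2 \<omega> \<omega> (c, c) x)"
      unfolding bilinear_def linear_iff \<omega>[OF x]
      by (simp add: matrix_vector_right_distrib matrix_vector_mult_scaleR inner_left_distrib
          inner_right_distrib algebra_simps)
    show "ominus2 \<omega> \<omega> (c, c) x u u = 0"
      \<comment> \<open>With equal arguments, antisymmetry says that each term is its own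
        negative.\<close>
      using antisym_inner[OF J(1), of "fst u" "fst u"] antisym_inner[OF J(1), of "snd u" "snd u"]
      by (simp add: \<omega>[OF x])
  next
    fix u v
    show "smooth_on ?V (\<lambda>x. ominus2 \<omega> \<omega> (c, c) x u v)"
      by (rule smooth_on_cong[OF op _ smooth_on_const[of _ "?w u v"]]) (simp add: \<omega>)
  qed
  moreover have "ext_d2 (ominus2 \<omega> \<omega> (c, c)) x u v w = 0" if "x \<in> ?V" for x u v w
  proof -
    have "frechet_derivative (\<lambda>y. ominus2 \<omega> \<omega> (c, c) y a b) (at x) = (\<lambda>_. 0)" for a b
      using frechet_derivative_transform_within_open[OF _ op that,
          of "\<lambda>_. ?w a b" "\<lambda>y. ominus2 \<omega> \<omega> (c, c) y a b"]
      by (simp add: \<omega>)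
    then show ?thesis by (simp add: ext_d2_def)
  qed
  moreover have "u = 0" if "x \<in> ?V" "\<forall>v. ominus2 \<omega> \<omega> (c, c) x u v = 0" for x u
  proof -
    have w: "?w u v = 0" for v
      using that \<omega> by auto
    \<comment> \<open>These test vectors isolate one factor each and turn \<open>?w\<close> into
      plus or minus the squared norm of \<open>J *v fst u\<close> or
      \<open>J *v snd u\<close>.\<close>
    have "J *v fst u = 0" "J *v snd u = 0"
      using w[of "(J *v fst u, 0)"] w[of "(0, J *v snd u)"] by auto
    then show ?thesis
      using complex_structure_mult_eq_0[OF J(2)] by (simp add: prod_eq_iff)
  qed
  ultimately show ?thesis
    using smooth_manifold_chart_prod_mfd[OF M M c c] by (simp add: symplectic_manifold_def)
qed

text \<open>On each factor this is the computation for the elementary form. The coordinate formula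
  makes sense on the whole model space and is linear in the base point, so it is differentiated
  without localizing; only the comparison with \<open>ominus2 \<omega> \<omega>\<close> needs a
  point of \<open>?V\<close>.\<close>

lemma liouvillian_ominus_elementary_form:
  assumes "symplectic_manifold M \<omega>" and "symplectic_coords M \<omega> J c"
  shows "liouvillian (chart_mfd (prod_mfd M M) (c, c)) (ominus2 \<omega> \<omega>)
    (ominus1 (elementary_form J) (elementary_form J))"
proof -
  have c: "c \<in> charts M" and J: "transpose J = - J"
    and coords: "\<And>x. x \<in> crange M c \<Longrightarrow> \<omega> c x = const_form2 J x"
    using assms(2) by (auto simp: symplectic_coords_def)
  let ?V = "crange (prod_mfd M M) (c, c)"
  let ?\<theta> = "ominus1 (elementary_form J) (elementary_form J)"
  have op: "open ?V"
    using assms(1) c by (simp add: crange_prod_mfd open_Times symplectic_manifold_def smooth_manifold_def)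
  have \<theta>: "?\<theta> (c, c) x v =
      matrix_form ((1/2) *\<^sub>R J) (fst x) (fst v) - matrix_form ((1/2) *\<^sub>R J) (snd x) (snd v)" for x v
    by (simp add: ominus1_apply elementary_form_def)
  have lin: "bounded_linear (\<lambda>x. ?\<theta> (c, c) x v)" for v
    unfolding \<theta>
    by (intro bounded_linear_sub bounded_linear_compose[OF bounded_linear_matrix_form]
        bounded_linear_fst bounded_linear_snd)
  have "linear (?\<theta> (c, c) x)" for x
    by (simp add: linear_iff \<theta> matrix_form_inner inner_right_distrib algebra_simps)
  then have "one_form (chart_mfd (prod_mfd M M) (c, c)) ?\<theta>"
    by (simp add: one_form_chart_mfd[OF op] smooth_on_bounded_linear[OF lin])
  moreover have "ext_d1 (?\<theta> (c, c)) x u v = ominus2 \<omega> \<omega> (c, c) x u v" if "x \<in> ?V" for x u v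
    unfolding ext_d1_def frechet_derivative_bounded_linear[OF lin]
    using that antisym_inner[OF J, of "fst v" "fst u"] antisym_inner[OF J, of "snd v" "snd u"]
    by (auto simp: ominus2_apply crange_prod_mfd coords const_form2_inner[OF J] \<theta> matrix_form_inner
        scaleR_matrix_vector_assoc[symmetric])
  ultimately show ?thesis
    using symplectic_chart_prod_mfd[OF assms] by (simp add: liouvillian_def fun_eq_iff)
qed

lemma matrix_form_darboux_J:
  "matrix_form darboux_J (qp q p) (qp dq dp) = p \<bullet> dq - q \<bullet> dp"
proof -
  have "darboux_J *v qp q p = qp p (- q)"
    \<comment> \<open>Reading \<open>UNIV_Plus_UNIV\<close> backwards splits a sum over the index
      type into its \<open>q\<close> and \<open>p\<close> blocks.\<close>
    by (simp add: vec_eq_iff matrix_vector_mult_def darboux_J_def qp_def sum_negf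
        UNIV_Plus_UNIV[symmetric] sum.Plus if_distrib[of "\<lambda>x. x * _"] cong: if_cong split: sum.split
        del: UNIV_Plus_UNIV)
  then show ?thesis
    by (simp add: matrix_form_inner inner_vec_def qp_def UNIV_Plus_UNIV[symmetric] sum.Plus
        sum_negf del: UNIV_Plus_UNIV)
qed

subsection \<open>The associated scheme\<close>

lemma euler_scheme_zero: "euler_scheme V J 0 X h = midpoint_rule V X h"
  by (simp add: euler_scheme_def midpoint_rule_def Let_def)

lemma euler_scheme_eq_midpoint_rule:
  fixes J S :: "real^'k^'k"
  assumes "open V"
    and eq: "\<And>x. x \<in> V \<times> V \<Longrightarrow>
      ominus1 (elementary_form J) (elementary_form J) (c, c) x = liouvillian_of J S (c, c) x"
  shows "euler_scheme V J S X h = midpoint_rule V X h"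
proof (cases "V = {}")
  case True
  then show ?thesis by (simp add: euler_scheme_def midpoint_rule_def)
next
  case False
  have "S *v z = 0" if "z \<in> V" for z
  proof -
    \<comment> \<open>The diagonal point lies in \<open>V \<times> V\<close>, and the zero second
      component of the tangent vector removes the second factor. The terms with \<open>J\<close>
      cancel and \<open>(S *v z) \<bullet> v = 0\<close> remains.\<close>
    have "ominus1 (elementary_form J) (elementary_form J) (c, c) (z, z) (v, 0) =
        liouvillian_of J S (c, c) (z, z) (v, 0)" for v
      using eq[of "(z, z)"] that by simp
    then have "(S *v z) \<bullet> v = 0" for v
      by (simp add: liouvillian_of_def ominus1_apply elementary_form_def matrix_form_inner
          matrix_vector_mult_add_rdistrib inner_left_distrib)
    then show ?thesis by (metis inner_eq_zero_iff)
  qed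
  then have "S = 0"
    using matrix_eq_0_if_vanishes_on_open[OF assms(1)] False by blast
  then show ?thesis by (simp add: euler_scheme_zero)
qed

text \<open>Association quantifies existentially over \<open>S\<close>. Every admissible
  \<open>S\<close> yields the same relation, which gives one direction; \<open>S = 0\<close> is the
  witness for the other.\<close>

lemma associated_euler_scheme_elementary_form:
  fixes M :: "('m, real^'k, 'i) mfd"
  assumes "open (crange M c)"
  shows "associated_euler_scheme M \<omega> J c (ominus1 (elementary_form J) (elementary_form J)) H h R \<longleftrightarrow>
    R = midpoint_rule (crange M c) (hamiltonian_field M \<omega> H c) h"
proof
  assume "associated_euler_scheme M \<omega> J c (ominus1 (elementary_form J) (elementary_form J)) H h R"
  then show "R = midpoint_rule (crange M c) (hamiltonian_field M \<omega> H c) h"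
    unfolding associated_euler_scheme_def crange_prod_mfd
    using euler_scheme_eq_midpoint_rule[OF assms] by metis
next
  assume "R = midpoint_rule (crange M c) (hamiltonian_field M \<omega> H c) h"
  moreover have "transpose (0 :: real^'k^'k) = 0"
    by (simp add: transpose_def vec_eq_iff)
  moreover have "ominus1 (elementary_form J) (elementary_form J) (c, c) = liouvillian_of J 0 (c, c)"
    by (simp add: fun_eq_iff liouvillian_of_def ominus1_apply elementary_form_def)
  ultimately show "associated_euler_scheme M \<omega> J c
      (ominus1 (elementary_form J) (elementary_form J)) H h R"
    unfolding associated_euler_scheme_def using euler_scheme_zero by metis
qed

theorem proposition3:
  fixes M :: "('m, real^('n::finite + 'n), 'i) mfd"
    and \<omega> :: "('i, real^('n + 'n)) form2"
    and J :: "real^('n + 'n)^('n + 'n)"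
    and c :: 'i
    and \<theta>0 :: "('i, real^('n + 'n)) form1"
    and \<theta> :: "('i \<times> 'i, (real^('n + 'n)) \<times> (real^('n + 'n))) form1"
  assumes "exact_symplectic_manifold M \<omega>"
    and "symplectic_coords M \<omega> J c"
    and "\<theta>0 = elementary_form J"
    and "\<theta> = ominus1 \<theta>0 \<theta>0"
  shows "liouvillian (chart_mfd M c) \<omega> \<theta>0 \<and>
     liouvillian (chart_mfd (prod_mfd M M) (c, c)) (ominus2 \<omega> \<omega>) \<theta> \<and>
     (\<forall>z0\<in>crange M c. \<forall>zh\<in>crange M c. \<forall>dz0 dzh.
        \<theta> (c, c) (z0, zh) (dz0, dzh) = 1/2 * matrix_form J z0 dz0 - 1/2 * matrix_form J zh dzh) \<and>
     (J = darboux_J \<longrightarrow>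
        (\<forall>q0 p0 qh ph dq0 dp0 dqh dph. qp q0 p0 \<in> crange M c \<longrightarrow> qp qh ph \<in> crange M c \<longrightarrow>
           \<theta> (c, c) (qp q0 p0, qp qh ph) (qp dq0 dp0, qp dqh dph) =
             1/2 * (p0 \<bullet> dq0 - q0 \<bullet> dp0 - ph \<bullet> dqh + qh \<bullet> dph))) \<and>
     (\<forall>H h R. smooth_function M H \<longrightarrow>
        (associated_euler_scheme M \<omega> J c \<theta> H h R \<longleftrightarrow>
         R = midpoint_rule (crange M c) (hamiltonian_field M \<omega> H c) h))"
proof -
  have symp: "symplectic_manifold M \<omega>"
    using assms(1) by (simp add: exact_symplectic_manifold_def)
  have op: "open (crange M c)"
    using symp assms(2)
    by (auto simp: symplectic_coords_def symplectic_manifold_def smooth_manifold_def)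
  have \<theta>: "\<theta> (c, c) (z0, zh) (dz0, dzh) = 1/2 * matrix_form J z0 dz0 - 1/2 * matrix_form J zh dzh"
    for z0 zh dz0 dzh
    by (simp add: assms(3,4) ominus1_apply elementary_form_def matrix_form_inner
        scaleR_matrix_vector_assoc[symmetric])
  show ?thesis
  proof (intro conjI allI ballI impI)
    show "liouvillian (chart_mfd M c) \<omega> \<theta>0"
      unfolding assms(3) by (rule liouvillian_elementary_form[OF symp assms(2)])
    show "liouvillian (chart_mfd (prod_mfd M M) (c, c)) (ominus2 \<omega> \<omega>) \<theta>"
      unfolding assms(3,4) by (rule liouvillian_ominus_elementary_form[OF symp assms(2)])
  next
    fix q0 p0 qh ph dq0 dp0 dqh dph
    assume "J = darboux_J"
    then show "\<theta> (c, c) (qp q0 p0, qp qh ph) (qp dq0 dp0, qp dqh dph) =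
        1/2 * (p0 \<bullet> dq0 - q0 \<bullet> dp0 - ph \<bullet> dqh + qh \<bullet> dph)"
      by (simp add: \<theta> matrix_form_darboux_J field_simps)
  next
    fix H h R
    show "associated_euler_scheme M \<omega> J c \<theta> H h R \<longleftrightarrow>
        R = midpoint_rule (crange M c) (hamiltonian_field M \<omega> H c) h"
      unfolding assms(3,4) by (rule associated_euler_scheme_elementary_form[OF op])
  \<comment> \<open>The goal left over is the coordinate formula for \<open>\<theta>\<close>,
    established above for all points of the model space.\<close>
  qed (rule \<theta>)
qed

end
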